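(* Let $p,q$ be positive integers with $p\geq q$ and $p\geq 2$, and let $\mathcal{L}$ denote the equation $px+qy=z$. If $n$ is sufficiently large (depending on $p,q$) then $\mu_{\mathcal{L}}(n)=n-\lfloor \frac{n}{p+q}\rfloor$.
   Context: $[n]=\{1,\dots,n\}$. A set $A\subseteq[n]$ is $\mathcal{L}$-free, for $\mathcal{L}$ the equation $px+qy=z$ with $p,q$ as in the statement, if there are no $x,y,z\in A$ (not necessarily distinct) with $px+qy=z$ (such an equation has no trivial solutions). $\mu_{\mathcal{L}}(n)$ denotes the size of the largest $\mathcal{L}$-free subset of $[n]$. *)

theory Defs
  imports Complex_Main
begin

definition L_free :: "nat \<Rightarrow> nat \<Rightarrow> nat set \<Rightarrow> bool" where
  "L_free p q A \<longleftrightarrow> \<not> (\<exists>x\<in>A. \<exists>y\<in>A. \<exists>z\<in>A. p * x + q * y = z)"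

(* The family is finite and contains the empty set, so Max is attained. *)
definition mu_L :: "nat \<Rightarrow> nat \<Rightarrow> nat \<Rightarrow> nat" where
  "mu_L p q n = Max (card ` {A. A \<subseteq> {1..n} \<and> L_free p q A})"

end

theory Submission
  imports Defs
begin

text \<open>
  The set \<open>{\<lfloor>n/(p+q)\<rfloor>+1..n}\<close> is free, which gives the lower bound. For the upper bound, let \<open>m\<close> be
  the least element of a free set \<open>A\<close>, put \<open>k = \<lfloor>n/(p+q)\<rfloor>\<close> and let \<open>T(N)\<close> count the elements of
  \<open>{1..N}\<close> missing from \<open>A\<close>. The injection \<open>x \<mapsto> q x + p m\<close> sends elements of \<open>A\<close> to missing ones;
  applied to \<open>A \<inter> {a+1..b}\<close> where its values lie in \<open>{b+1..N}\<close>, it yields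
  \<open>T(N) \<ge> (b - a) + T(a)\<close>. If \<open>k < (p+q) m\<close>, take \<open>a = m - 1\<close> and \<open>b = k\<close>. Otherwise take the largest
  possible \<open>b\<close> and the smallest possible \<open>a\<close>: for \<open>q \<ge> 2\<close> a single application with
  \<open>T(a) \<ge> m - 1\<close> suffices, and for \<open>q = 1\<close> one iterates.
\<close>

text \<open>On \<open>{k..n}\<close> the smallest value of \<open>p * x + q * y\<close> is
  \<open>(p + q) * k\<close>, which already exceeds \<open>n\<close>.\<close>

lemma L_free_interval:
  assumes "n < (p + q) * k"
  shows "L_free p q {k..n}"
proof -
  have "n < p * x + q * y" if "k \<le> x" "k \<le> y" for x y
  proof -
    have "p * k + q * k \<le> p * x + q * y" using that by (intro add_mono mult_le_mono2)
    with assms show ?thesis by (simp add: algebra_simps)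
  qed
  then show ?thesis unfolding L_free_def by force
qed

text \<open>Each \<open>x\<close> in \<open>{a+1..b}\<close> is charged to one missing element:
  itself if it is missing, otherwise its image. By \<open>ba\<close> all images exceed
  \<open>b\<close>, so none is a missing element of \<open>{1..b}\<close>; by \<open>bN\<close> they
  stay at most \<open>N\<close>.\<close>

lemma card_missing_step:
  fixes p q m a b N :: nat
  assumes free: "L_free p q A" and m: "m \<in> A" and q: "q \<ge> 1"
    and ab: "a \<le> b" and bN: "q * b + p * m \<le> N" and ba: "b < q * (a + 1) + p * m"
  shows "b + card ({1..a} - A) \<le> card ({1..N} - A) + a"
proof -
  let ?f = "\<lambda>x. q * x + p * m"
  let ?I = "{a+1..b}"
  have f_gt: "b < ?f x" if "x \<in> ?I" for x
  proof -
    have "q * (a + 1) \<le> q * x" using that by (intro mult_le_mono2) auto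
    with ba show ?thesis by linarith
  qed
  have f_le: "?f x \<le> N" if "x \<in> ?I" for x
  proof -
    have "q * x \<le> q * b" using that by (intro mult_le_mono2) auto
    with bN show ?thesis by linarith
  qed
  have f_notin: "?f x \<notin> A" if "x \<in> A" for x
    using free m that unfolding L_free_def by (metis add.commute)
  have inj: "inj_on ?f (?I \<inter> A)" using q by (auto simp: inj_on_def)
  have "b \<le> q * b" using q by simp
  with bN have "b \<le> N" by linarith
  then have sub: "({1..b} - A) \<union> ?f ` (?I \<inter> A) \<subseteq> {1..N} - A"
    using f_gt f_le f_notin by fastforce
  have disj: "({1..b} - A) \<inter> ?f ` (?I \<inter> A) = {}" using f_gt by fastforce
  have "card ({1..b} - A) + card (?I \<inter> A) = card (({1..b} - A) \<union> ?f ` (?I \<inter> A))"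
    unfolding card_image[OF inj, symmetric] by (rule card_Un_disjoint[symmetric]) (use disj in auto)
  also have "\<dots> \<le> card ({1..N} - A)" using sub by (intro card_mono) auto
  finally have 1: "card ({1..b} - A) + card (?I \<inter> A) \<le> card ({1..N} - A)" .
  have "{1..b} - A = ({1..a} - A) \<union> (?I - A)" using ab by auto
  then have 2: "card ({1..b} - A) = card ({1..a} - A) + card (?I - A)"
    by (simp add: card_Un_disjoint disjoint_iff)
  have "card (?I - A) + card (?I \<inter> A) = card ?I"
    by (metis card_Int_Diff add.commute finite_atLeastAtMost)
  then have 3: "card (?I - A) + card (?I \<inter> A) + a = b" using ab by simp
  from 1 2 3 show ?thesis by linarith
qed

lemma card_missing_below_least:
  fixes m a :: nat
  assumes "\<And>x. x \<in> A \<Longrightarrow> m \<le> x" and "m \<le> a + 1"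
  shows "m - 1 \<le> card ({1..a} - A)"
proof -
  have "{1..m-1} \<subseteq> {1..a} - A" using assms by fastforce
  then have "card {1..m-1} \<le> card ({1..a} - A)" by (intro card_mono) auto
  then show ?thesis by simp
qed

text \<open>With \<open>a = m - 1\<close> and \<open>b = k\<close>, \<open>km\<close> says that the
  image \<open>(p + q) * m\<close> of \<open>m\<close> lies beyond \<open>k\<close>. All of
  \<open>{1..m-1}\<close> is missing, which cancels the loss of \<open>a\<close>.\<close>

lemma card_missing_large_least:
  fixes p q m N :: nat
  assumes free: "L_free p q A" and m: "m \<in> A" "m > 0" "\<And>x. x \<in> A \<Longrightarrow> m \<le> x"
    and q: "q \<ge> 1" and mk: "m \<le> k" and kN: "(p + q) * k \<le> N" and km: "k < (p + q) * m"
  shows "k \<le> card ({1..N} - A)"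
proof -
  have "p * m \<le> p * k" using mk by (rule mult_le_mono2)
  with kN have "q * k + p * m \<le> N" unfolding add_mult_distrib by linarith
  moreover have "k < q * (m - 1 + 1) + p * m" using km m(2) by (simp add: algebra_simps)
  ultimately have "k + card ({1..m-1} - A) \<le> card ({1..N} - A) + (m - 1)"
    using card_missing_step[OF free m(1) q, of "m-1" k N] mk by simp
  moreover have "m - 1 \<le> card ({1..m-1} - A)"
    using card_missing_below_least[OF m(3)] by simp
  ultimately show ?thesis by linarith
qed

lemma card_missing_coeff_one:
  fixes p m N :: nat
  assumes free: "L_free p 1 A" and m: "m \<in> A" "m > 0" "\<And>x. x \<in> A \<Longrightarrow> m \<le> x"
    and p: "p \<ge> 2" and N: "(p + 1) * m \<le> N"
  shows "N div (p + 1) \<le> card ({1..N} - A)"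
  using N
proof (induction N rule: less_induct)
  case (less N)
  define k where "k = N div (p + 1)"
  have kN: "(p + 1) * k \<le> N" unfolding k_def by (rule times_div_less_eq_dividend)
  have mk: "m \<le> k" unfolding k_def using less.prems by (simp add: less_eq_div_iff_mult_less_eq mult.commute)
  show ?case
  proof (cases "k < (p + 1) * m")
    case True
    from card_missing_large_least[OF free m _ mk kN True] show ?thesis unfolding k_def by simp
  next
    case False
    \<comment> \<open>For \<open>q = 1\<close> the map is the shift by \<open>p * m\<close>, taking
      the lower half of the block \<open>{a+1..N}\<close> to the upper half. So the block has at
      least \<open>p * m\<close> missing elements, while the quotient by \<open>p + 1\<close> drops
      by at most \<open>p * m\<close>.\<close>
    define a where "a = N - 2 * p * m"
    have "(p + 1) * ((p + 1) * m) \<le> (p + 1) * k" using False by (intro mult_le_mono2) simp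
    with kN have "(p + 1) * ((p + 1) * m) \<le> N" by linarith
    then have big: "p * (p * m) + 2 * p * m + m \<le> N" by (simp add: algebra_simps)
    have pm: "2 * (p * m) \<le> p * (p * m)" using p by (intro mult_le_mono1)
    have Na: "N = a + 2 * p * m" unfolding a_def using big by simp
    \<comment> \<open>The shortened range still meets the lower bound that the induction
      requires.\<close>
    have am: "(p + 1) * m \<le> a" using big pm Na unfolding add_mult_distrib by linarith
    have "0 < p * m" using p m(2) by simp
    then have IH: "a div (p + 1) \<le> card ({1..a} - A)"
      using less.IH[OF _ am] Na by simp
    have step: "(a + p * m) + card ({1..a} - A) \<le> card ({1..N} - A) + a"
      using card_missing_step[OF free m(1), of a "a + p * m" N] Na by simp
    have "2 * p * m \<le> (p + 1) * (p * m)" using pm by (simp add: algebra_simps)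
    with Na have "N \<le> a + (p + 1) * (p * m)" by linarith
    then have "N div (p + 1) \<le> (a + (p + 1) * (p * m)) div (p + 1)" by (rule div_le_mono)
    also have "\<dots> = p * m + a div (p + 1)" by (subst div_mult_self2) simp_all
    finally show ?thesis using IH step by linarith
  qed
qed

text \<open>Up to rounding, \<open>b - a\<close> is
  \<open>(N * (q - 1) + p * m) / q\<^sup>2\<close>, while \<open>k\<close> is at most
  \<open>N / (2 * q)\<close> because \<open>p \<ge> q\<close>. The former wins since
  \<open>2 * (q - 1) \<ge> q\<close>; the bound on \<open>N\<close> controls the rounding.\<close>

lemma card_missing_coeff_ge_two:
  fixes p q m N :: nat
  assumes free: "L_free p q A" and m: "m \<in> A" "m > 0" "\<And>x. x \<in> A \<Longrightarrow> m \<le> x"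
    and q: "q \<ge> 2" and pq: "p \<ge> q" and mk: "m \<le> k" and kN: "(p + q) * k \<le> N"
    and N: "2 * q\<^sup>2 \<le> N"
  shows "k \<le> card ({1..N} - A)"
proof (cases "k < (p + q) * m")
  case True
  show ?thesis using card_missing_large_least[OF free m _ mk kN True] q by simp
next
  case False
  define b where "b = (N - p * m) div q"
  define a where "a = (b - p * m) div q"
  have "p * m \<le> p * k" using mk by (rule mult_le_mono2)
  with kN have kb': "k * q + p * m \<le> N"
    unfolding add_mult_distrib mult.commute[of k q] by linarith
  have "k \<le> b" unfolding b_def using kb' q by (simp add: less_eq_div_iff_mult_less_eq)
  with False have mb: "m * q + p * m \<le> b" by (simp add: algebra_simps)
  have ma: "m \<le> a" unfolding a_def using mb q by (simp add: less_eq_div_iff_mult_less_eq)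
  have b1: "q * b \<le> N - p * m" unfolding b_def by simp
  have b2: "N - p * m < q * (b + 1)"
    unfolding b_def using q dividend_less_times_div[of q "N - p * m"] by simp
  have a1: "q * a \<le> b - p * m" unfolding a_def by simp
  have a2: "b - p * m < q * (a + 1)"
    unfolding a_def using q dividend_less_times_div[of q "b - p * m"] by simp
  have "a \<le> q * a" using q by simp
  with a1 have ab: "a \<le> b" by linarith
  have "b + card ({1..a} - A) \<le> card ({1..N} - A) + a"
    by (rule card_missing_step[OF free m(1)]) (use q ab b1 kb' a2 in linarith)+
  moreover have "m - 1 \<le> card ({1..a} - A)"
    using card_missing_below_least[OF m(3)] ma by simp
  moreover have "k + a + 1 \<le> b + m"
  proof -
    \<comment> \<open>Over the integers subtraction is not truncated.\<close>
    define P Q M K B C n where "P = int p" "Q = int q" "M = int m" "K = int k"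
      "B = int b" "C = int a" "n = int N"
    note defs = this
    have i1: "n - P * M - Q + 1 \<le> Q * B"
    proof -
      have "N + 1 \<le> q * b + q + p * m" using b2 by simp
      then have "int (N + 1) \<le> int (q * b + q + p * m)" by (simp only: of_nat_le_iff)
      then show ?thesis unfolding defs by simp
    qed
    have i2: "Q * C \<le> B - P * M"
    proof -
      have "q * a + p * m \<le> b" using a1 mb by linarith
      then have "int (q * a + p * m) \<le> int b" by (simp only: of_nat_le_iff)
      then show ?thesis unfolding defs by simp
    qed
    have i3: "(P + Q) * K \<le> n"
    proof -
      have "int ((p + q) * k) \<le> int N" using kN by (simp only: of_nat_le_iff)
      then show ?thesis unfolding defs by simp
    qed
    have i4: "2 * Q\<^sup>2 \<le> n"
    proof -
      have "int (2 * q\<^sup>2) \<le> int N" using N by (simp only: of_nat_le_iff)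
      then show ?thesis unfolding defs by simp
    qed
    have pos: "Q \<ge> 2" "P \<ge> Q" "M \<ge> 1" "K \<ge> 0" using q pq m(2) unfolding defs by auto
    have "(2 * Q) * K \<le> (P + Q) * K" using pos by (intro mult_right_mono) auto
    with i3 have "2 * Q * K \<le> n" by linarith
    then have j1: "Q * (2 * Q * K) \<le> Q * n" using pos by (intro mult_left_mono) auto
    have j2: "(Q - 1) * (n - P * M - Q + 1) \<le> (Q - 1) * (Q * B)"
      using i1 pos by (intro mult_left_mono) auto
    have j3: "Q * (Q * C) \<le> Q * (B - P * M)" using i2 pos by (intro mult_left_mono) auto
    have j4: "Q * 1 \<le> P * M" using pos by (intro mult_mono) auto
    have j5: "0 \<le> Q\<^sup>2 * (M - 1)" using pos by simp
    \<comment> \<open>The term \<open>2 * (Q - 1)\<^sup>2\<close> is the rounding loss. For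
      \<open>Q = 2\<close> it is covered by \<open>2 * Q\<close>, for \<open>Q \<ge> 3\<close> by
      \<open>n \<ge> 2 * Q\<^sup>2\<close>.\<close>
    have j6: "0 \<le> (Q - 2) * n + 2 * Q - 2 * (Q - 1)\<^sup>2"
    proof (cases "Q = 2")
      case False
      then have "1 * n \<le> (Q - 2) * n" using pos i4 by (intro mult_right_mono) (auto simp: defs)
      moreover have "2 * (Q - 1)\<^sup>2 = 2 * Q\<^sup>2 - 4 * Q + 2" by (simp add: power2_eq_square algebra_simps)
      ultimately show ?thesis using i4 pos by linarith
    qed simp
    \<comment> \<open>This is the sum of \<open>j1\<close>, \<open>j6\<close> and twice each of
      \<open>j2\<close> to \<open>j5\<close>.\<close>
    have "0 \<le> 2 * (Q\<^sup>2 * (B + M - K - C - 1))"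
      using j1 j2 j3 j4 j5 j6 by (simp add: power2_eq_square algebra_simps)
    then have "0 \<le> B + M - K - C - 1" using pos by (simp add: zero_le_mult_iff)
    then show ?thesis unfolding defs by simp
  qed
  ultimately show ?thesis using m(2) by linarith
qed

lemma card_missing_ge:
  fixes p q n :: nat
  assumes free: "L_free p q A" and A: "A \<subseteq> {1..n}"
    and q: "q \<ge> 1" and pq: "p \<ge> q" and p: "p \<ge> 2" and n: "2 * q\<^sup>2 \<le> n"
  shows "n div (p + q) \<le> card ({1..n} - A)"
proof (cases "A = {}")
  case True
  then show ?thesis by simp
next
  case False
  define m where "m = (LEAST x. x \<in> A)"
  from False have m: "m \<in> A" unfolding m_def by (auto intro: LeastI)
  have least: "m \<le> x" if "x \<in> A" for x unfolding m_def using that by (rule Least_le)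
  have m0: "m > 0" and mn: "m \<le> n" using m A by auto
  show ?thesis
  proof (cases "m \<le> n div (p + q)")
    case True
    show ?thesis
    proof (cases "q = 1")
      case True
      have "(p + 1) * m \<le> n" using \<open>m \<le> n div (p + q)\<close> True
        by (simp add: less_eq_div_iff_mult_less_eq mult.commute)
      then show ?thesis using card_missing_coeff_one[OF _ m m0 least p] free True by simp
    next
      case False
      then show ?thesis
        using card_missing_coeff_ge_two[OF free m m0 least _ pq \<open>m \<le> n div (p + q)\<close> _ n] q by simp
    qed
  next
    case False
    \<comment> \<open>Here the elements below \<open>m\<close> alone are enough missing
      ones.\<close>
    have "m - 1 \<le> card ({1..n} - A)" by (rule card_missing_below_least[OF least]) (use mn in auto)
    with False show ?thesis by linarith
  qed
qed

theorem corollary2: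
  fixes p q :: nat
  assumes "q \<ge> 1" and "p \<ge> q" and "p \<ge> 2"
  shows "\<exists>N. \<forall>n\<ge>N. int (mu_L p q n) = int n - \<lfloor>real n / real (p + q)\<rfloor>"
proof (intro exI allI impI)
  fix n :: nat
  \<comment> \<open>This threshold comes from the rounding estimate for
    \<open>q \<ge> 2\<close>.\<close>
  assume n: "2 * q\<^sup>2 \<le> n"
  define k where "k = n div (p + q)"
  let ?F = "{A. A \<subseteq> {1..n} \<and> L_free p q A}"
  have "n < (p + q) * (k + 1)"
    unfolding k_def using assms dividend_less_times_div[of "p + q" n] by simp
  then have "{k+1..n} \<in> ?F" using L_free_interval by auto
  then have "card {k+1..n} \<in> card ` ?F" by (rule imageI)
  then have mem: "n - k \<in> card ` ?F" by simp
  have upper: "card A \<le> n - k" if "A \<in> ?F" for A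
  proof -
    from that have A: "A \<subseteq> {1..n}" and "L_free p q A" by auto
    then have "k \<le> card ({1..n} - A)" unfolding k_def using card_missing_ge assms n by blast
    moreover have "card ({1..n} - A) = n - card A"
      using A by (simp add: card_Diff_subset finite_subset)
    moreover have "card A \<le> n" using card_mono[OF _ A] by simp
    ultimately show ?thesis by linarith
  qed
  have "mu_L p q n = n - k"
    unfolding mu_L_def by (rule Max_eqI) (use mem upper in auto)
  moreover have "\<lfloor>real n / real (p + q)\<rfloor> = int k"
    unfolding k_def by (rule floor_divide_of_nat_eq)
  moreover have "k \<le> n" unfolding k_def by simp
  ultimately show "int (mu_L p q n) = int n - \<lfloor>real n / real (p + q)\<rfloor>" by simp
qed

end
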